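(* Consider a nonempty finite collocation set $\Omega^h\subset\Omega$, let $L\ge2$, and let $H$ denote the set of (restrictions to $\Omega$ of) depth-$L$ neural networks with either (i) ReLU activation function $\sigma(x)=\max\{0,x\}$, or (ii) a non-polynomial activation function $\sigma\in C(\mathbb R)$ that is strictly monotone if $L>2$, or (iii) an activation function $\sigma\in C^{\ell}(\mathbb R)$, $\ell:=|\Omega^h|$, satisfying $D^k\sigma(s)\neq0$ for some $s\in\mathbb R$ and all $0\le k\le\ell$, that is strictly monotone if $L>2$. If $\operatorname{argmin}_{u_\theta\in H}\mathcal J_{\mathrm{reg}}^{h,\theta}(u_\theta)$ has a solution, then it has infinitely many solutions in $H$.
   Context: Let $d\in\mathbb N$ and let $\Omega\subset\mathbb R^d$ be a bounded open domain with Lipschitz boundary. $|A|$ denotes the cardinality of a finite set $A$. Neural networks. For a fixed activation $\sigma:\mathbb R\to\mathbb R$ and depth $L\in\mathbb N$, a depth-$L$ neural network is a function $f:\mathbb R^d\to\mathbb R$ of the form $\varphi_0(x)=x$, $\varphi_i(x)=\sigma(W_i\varphi_{i-1}(x)+b_i)$ for $i=1,\dots,L-1$ ($\sigma$ applied componentwise), $f(x)=W_L\varphi_{L-1}(x)+b_L$, with $W_i\in\mathbb R^{d_i\times d_{i-1}}$, $b_i\in\mathbb R^{d_i}$, $d_0=d$, $d_L=1$, and arbitrary hidden widths $d_1,\dots,d_{L-1}\in\mathbb N$. All networks in $H$ use the same activation $\sigma$ and the same depth $L$, and all hidden widths are allowed. Elements of $H$ are regarded as functions on $\Omega$, so "infinitely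 many" refers to distinct functions. Finite-difference regularization loss. Let $m\in\mathbb N$, let $\eta:=\sum_{k=1}^m\binom{d+k-1}{k}$ be the number of multi-indices $\beta\in\mathbb N_0^d$ with $1\le|\beta|\le m$, and let $R:\mathbb R^\eta\to[0,\infty]$ be Borel-measurable with $R(0)=0$. Let $\alpha_1,\alpha_2\ge0$, let $g^h:\Omega^h\to\mathbb R$ be given data, and let $\omega_{\mathcal D}^x,\omega_{\mathcal R}^x\ge0$ ($x\in\Omega^h$) be quadrature weights. For $1\le|\beta|\le m$, let $D_h^\beta$ be a finite difference approximation of $D^\beta$ on the grid $\Omega^h$; thus for each $x\in\Omega^h$ the number $D_h^\beta u(x)$ is a fixed linear combination of the grid values $(u(y))_{y\in\Omega^h}$. Then $$\mathcal J_{\mathrm{reg}}^{h,\theta}(u):=\sum_{\tau=1}^2\alpha_\tau\sum_{x\in\Omega^h}\omega_{\mathcal D}^x\,|u(x)-g^h(x)|^\tau+\sum_{x\in\Omega^h}\omega_{\mathcal R}^x\,R\big((D_h^\beta u(x))_{1\le|\beta|\le m}\big).$$ *)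

theory Defs
  imports
    "HOL-Analysis.Analysis"
    "HOL-Computational_Algebra.Polynomial"
    "Jordan_Normal_Form.Matrix"
begin

(* Jordan_Normal_Form.Matrix and HOL-Analysis share the notation "$" and the names vec and mat.
   Below, vec_nth and (real, 'n) vec come from HOL-Analysis; the matrices and vectors of
   varying size in the networks come from Jordan_Normal_Form. *)

text \<open>Near each boundary point the set is, in suitable orthonormal coordinates, the region on one
  side of the graph of a Lipschitz function. The unit vector \<open>\<nu>\<close> is the direction of the last
  coordinate axis, and \<open>\<gamma>\<close> is a function of the remaining coordinates, i.e. of the component
  orthogonal to \<open>\<nu>\<close>.\<close>

definition lipschitz_boundary :: "'a::euclidean_space set \<Rightarrow> bool" where
  "lipschitz_boundary \<Omega> \<longleftrightarrow>
    (\<forall>z\<in>frontier \<Omega>. \<exists>r>0. \<exists>\<nu>. \<exists>\<gamma> :: 'a \<Rightarrow> real. \<exists>K.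
       norm \<nu> = 1 \<and> K-lipschitz_on {y. y \<bullet> \<nu> = 0} \<gamma> \<and>
       \<Omega> \<inter> ball z r = {x \<in> ball z r. x \<bullet> \<nu> > \<gamma> (x - (x \<bullet> \<nu>) *\<^sub>R \<nu>)})"

definition bounded_lipschitz_domain :: "'a::euclidean_space set \<Rightarrow> bool" where
  "bounded_lipschitz_domain \<Omega> \<longleftrightarrow>
    open \<Omega> \<and> connected \<Omega> \<and> bounded \<Omega> \<and> lipschitz_boundary \<Omega>"

text \<open>The coordinates of a point, listed in a fixed enumeration of the index type.\<close>

definition coordinates :: "real ^ 'n \<Rightarrow> real Matrix.vec" where
  "coordinates x = Matrix.vec CARD('n) (\<lambda>i. vec_nth x (from_nat_into UNIV i))"

fun nn_layer :: "(real \<Rightarrow> real) \<Rightarrow> (nat \<Rightarrow> real Matrix.mat) \<Rightarrow> (nat \<Rightarrow> real Matrix.vec) \<Rightarrow>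
    real Matrix.vec \<Rightarrow> nat \<Rightarrow> real Matrix.vec" where
  "nn_layer \<sigma> W b x 0 = x"
| "nn_layer \<sigma> W b x (Suc i) =
     map_vec \<sigma> (W (Suc i) *\<^sub>v nn_layer \<sigma> W b x i + b (Suc i))"

text \<open>The output layer is not activated. It has width 1, and its only entry is the value.\<close>

definition nn_realization :: "(real \<Rightarrow> real) \<Rightarrow> nat \<Rightarrow> (nat \<Rightarrow> real Matrix.mat) \<Rightarrow>
    (nat \<Rightarrow> real Matrix.vec) \<Rightarrow> real ^ 'n \<Rightarrow> real" where
  "nn_realization \<sigma> L W b x =
     vec_index (W L *\<^sub>v nn_layer \<sigma> W b (coordinates x) (L - 1) + b L) 0"

definition neural_networks :: "(real \<Rightarrow> real) \<Rightarrow> nat \<Rightarrow> (real ^ 'n \<Rightarrow> real) set" where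
  "neural_networks \<sigma> L =
     {nn_realization \<sigma> L W b | W b.
        \<exists>w :: nat \<Rightarrow> nat. w 0 = CARD('n) \<and> w L = 1 \<and> (\<forall>i\<in>{1..<L}. w i \<ge> 1) \<and>
          (\<forall>i\<in>{1..L}. W i \<in> carrier_mat (w i) (w (i - 1)) \<and> b i \<in> carrier_vec (w i))}"

text \<open>Restrictions are extensional functions, so two elements are equal iff they agree on \<open>\<Omega>\<close>.\<close>

definition neural_networks_on ::
    "(real ^ 'n) set \<Rightarrow> (real \<Rightarrow> real) \<Rightarrow> nat \<Rightarrow> (real ^ 'n \<Rightarrow> real) set" where
  "neural_networks_on \<Omega> \<sigma> L = (\<lambda>f. restrict f \<Omega>) ` neural_networks \<sigma> L"

definition relu :: "real \<Rightarrow> real" where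
  "relu x = max 0 x"

definition polynomial_fun :: "(real \<Rightarrow> real) \<Rightarrow> bool" where
  "polynomial_fun f \<longleftrightarrow> (\<exists>p :: real poly. f = poly p)"

definition strictly_monotone :: "(real \<Rightarrow> real) \<Rightarrow> bool" where
  "strictly_monotone f \<longleftrightarrow> strict_mono f \<or> strict_antimono_on UNIV f"

definition C_k :: "nat \<Rightarrow> (real \<Rightarrow> real) \<Rightarrow> bool" where
  "C_k k f \<longleftrightarrow> (\<forall>j<k. ((deriv ^^ j) f) differentiable_on UNIV) \<and>
     continuous_on UNIV ((deriv ^^ k) f)"

definition multi_indices :: "nat \<Rightarrow> ('n::finite \<Rightarrow> nat) set" where
  "multi_indices m = {\<beta>. 1 \<le> (\<Sum>i\<in>UNIV. \<beta> i) \<and> (\<Sum>i\<in>UNIV. \<beta> i) \<le> m}"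

text \<open>A vector in \<open>\<real>\<^sup>\<eta>\<close> is an extensional function on the \<open>\<eta>\<close> multi-indices. The index set is
  finite, so the product \<open>\<sigma>\<close>-algebra is the Borel one.\<close>

abbreviation jet_space :: "nat \<Rightarrow> (('n::finite \<Rightarrow> nat) \<Rightarrow> real) measure" where
  "jet_space m \<equiv> PiM (multi_indices m) (\<lambda>_. borel)"

text \<open>The coefficient \<open>c \<beta> x y\<close> is the weight of the grid value at \<open>y\<close> in the finite difference
  approximation of the \<open>\<beta>\<close>-th derivative at \<open>x\<close>.\<close>

definition finite_difference ::
    "'a set \<Rightarrow> (('n \<Rightarrow> nat) \<Rightarrow> 'a \<Rightarrow> 'a \<Rightarrow> real) \<Rightarrow> ('n \<Rightarrow> nat) \<Rightarrow> ('a \<Rightarrow> real) \<Rightarrow> 'a \<Rightarrow> real" where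
  "finite_difference \<Omega>h c \<beta> u x = (\<Sum>y\<in>\<Omega>h. c \<beta> x y * u y)"

definition J_reg ::
    "(real ^ 'n) set \<Rightarrow> nat \<Rightarrow> (('n \<Rightarrow> nat) \<Rightarrow> real ^ 'n \<Rightarrow> real ^ 'n \<Rightarrow> real) \<Rightarrow>
     ((('n \<Rightarrow> nat) \<Rightarrow> real) \<Rightarrow> ennreal) \<Rightarrow> (nat \<Rightarrow> real) \<Rightarrow> (real ^ 'n \<Rightarrow> real) \<Rightarrow>
     (real ^ 'n \<Rightarrow> real) \<Rightarrow> (real ^ 'n \<Rightarrow> real) \<Rightarrow> (real ^ 'n \<Rightarrow> real) \<Rightarrow> ennreal" where
  "J_reg \<Omega>h m c R \<alpha> \<omega>D \<omega>R g u =
     ennreal (\<Sum>\<tau>=1..2. \<alpha> \<tau> * (\<Sum>x\<in>\<Omega>h. \<omega>D x * \<bar>u x - g x\<bar> ^ \<tau>)) +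
     (\<Sum>x\<in>\<Omega>h. ennreal (\<omega>R x) * R (\<lambda>\<beta>\<in>multi_indices m. finite_difference \<Omega>h c \<beta> u x))"

end

theory Submission
  imports Defs
begin

text \<open>
The loss sees a function only through its values on \<open>\<Omega>h\<close>, and the networks of a given depth form a
vector space, because networks can be stacked. If some network \<open>v\<close> vanishes on \<open>\<Omega>h\<close> but not at some
point of \<open>\<Omega>\<close>, then adding multiples of \<open>v\<close> to one minimizer gives infinitely many.

Such a \<open>v\<close> is found by duality (\<open>exists_vanishing_network\<close>). The first \<open>L - 2\<close> layers are used with
width one to build a function \<open>p\<close> that takes infinitely many values on \<open>\<Omega>\<close>
(\<open>exists_preactivation_with_infinite_image\<close>): a coordinate passes through injective activations, or,
for the rectifier, is shifted so far that the activation acts as the identity. Choose \<open>z \<in> \<Omega>\<close>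
with \<open>p z\<close> different from all \<open>p x\<close>, \<open>x \<in> \<Omega>h\<close>. If every network vanishing on \<open>\<Omega>h\<close> vanished
at \<open>z\<close>, evaluation at \<open>z\<close> would be a linear combination of the evaluations on \<open>\<Omega>h\<close>
(\<open>dependence_on_finitely_many_values\<close>). For the neurons \<open>\<sigma> (w * p x + b)\<close> this means
\<open>(\<Sum>i. c i * \<sigma> (w * y i + b)) = 0\<close> for all \<open>w\<close> and \<open>b\<close>, with nodes \<open>y i\<close> of which one is
separate from the others and has a nonzero coefficient.

This is impossible. Some moment \<open>\<Sum>i. c i * y i ^ k\<close> with \<open>k\<close> at most the number of points of \<open>\<Omega>h\<close>
is nonzero (\<open>exists_nonzero_moment\<close>). Formally, differentiating \<open>k\<close> times in \<open>w\<close> at \<open>w = 0\<close> shows that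
the \<open>k\<close>-th derivative of \<open>\<sigma>\<close> vanishes everywhere. In the smooth case this contradicts the
nonvanishing at \<open>s\<close> directly. In the continuous case it is made rigorous by
\<open>polynomial_of_ridge_relation\<close>, which concludes that \<open>\<sigma>\<close> is a polynomial; this also covers the
rectifier.
\<close>

section \<open>Dependent point evaluations\<close>

text \<open>This is the fact that a functional vanishing on the common kernel of finitely many functionals
is a linear combination of them, here for point evaluations. The induction passes to the subspace of
functions that vanish at the new point.\<close>

lemma dependence_on_finitely_many_values:
  fixes V :: "('a \<Rightarrow> real) set"
  assumes "finite Y"
    and "\<And>u v. u \<in> V \<Longrightarrow> v \<in> V \<Longrightarrow> (\<lambda>x. u x + v x) \<in> V"
    and "\<And>u t. u \<in> V \<Longrightarrow> (\<lambda>x. t * u x) \<in> V"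
    and "\<And>v. v \<in> V \<Longrightarrow> \<forall>y\<in>Y. v y = 0 \<Longrightarrow> v z = 0"
  shows "\<exists>c. \<forall>v\<in>V. v z = (\<Sum>y\<in>Y. c y * v y)"
  using assms
proof (induction Y arbitrary: V rule: finite_induct)
  case empty
  have "v z = 0" if "v \<in> V" for v
    using empty.prems(3)[OF that] by blast
  then show ?case by simp
next
  case (insert y Y)
  let ?W = "{v \<in> V. v y = 0}"
  have "\<exists>c. \<forall>v\<in>?W. v z = (\<Sum>y\<in>Y. c y * v y)"
    using insert.prems by (intro insert.IH) auto
  then obtain c where c: "v z = (\<Sum>y\<in>Y. c y * v y)" if "v \<in> V" "v y = 0" for v
    by blast
  show ?case
  proof (cases "\<forall>v\<in>V. v y = 0")
    case True
    then show ?thesis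
      using c insert.hyps by (intro exI[of _ c]) auto
  next
    case False
    then obtain v0 where v0: "v0 \<in> V" "v0 y \<noteq> 0" by blast
    define e where "e = (\<lambda>x. inverse (v0 y) * v0 x)"
    have e: "e \<in> V" "e y = 1"
      using v0 insert.prems(2)[OF v0(1)] by (auto simp: e_def)
    define a where "a = e z - (\<Sum>i\<in>Y. c i * e i)"
    have "v z = (\<Sum>i\<in>insert y Y. (c(y := a)) i * v i)" if v: "v \<in> V" for v
    proof -
      \<comment> \<open>Subtracting a multiple of \<open>e\<close> moves \<open>v\<close> into the subspace that vanishes at \<open>y\<close>.\<close>
      have "(\<lambda>x. v x + (- v y) * e x) \<in> V"
        using insert.prems(1)[OF v insert.prems(2)[OF e(1)]] .
      from c[OF this] e(2)
      have "v z - v y * e z = (\<Sum>i\<in>Y. c i * (v i - v y * e i))" by simp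
      also have "\<dots> = (\<Sum>i\<in>Y. c i * v i) - v y * (\<Sum>i\<in>Y. c i * e i)"
        by (simp add: algebra_simps sum_subtractf sum_distrib_left)
      finally have "v z = a * v y + (\<Sum>i\<in>Y. c i * v i)"
        by (simp add: a_def algebra_simps)
      also have "(\<Sum>i\<in>Y. c i * v i) = (\<Sum>i\<in>Y. (c(y := a)) i * v i)"
        using insert.hyps by (intro sum.cong) auto
      finally show ?thesis using insert.hyps by simp
    qed
    then show ?thesis by blast
  qed
qed

section \<open>Linear relations between ridge functions\<close>

text \<open>This replaces a Vandermonde determinant. The polynomial with roots \<open>y i\<close>, \<open>i \<in> I\<close>, has degree
\<open>card I\<close> and isolates the single term \<open>c j\<close>; if all moments up to that degree vanished, so would
this term. Nodes with indices in \<open>I\<close> are allowed to coincide, because distinct grid points may be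
mapped to the same node.\<close>

lemma exists_nonzero_moment:
  fixes c y :: "'a \<Rightarrow> real"
  assumes "finite I" and "j \<notin> I" and "y j \<notin> y ` I" and "c j \<noteq> 0"
  shows "\<exists>k\<le>card I. (\<Sum>i\<in>insert j I. c i * y i ^ k) \<noteq> 0"
proof (rule ccontr)
  assume "\<not> ?thesis"
  then have zero: "(\<Sum>i\<in>insert j I. c i * y i ^ k) = 0" if "k \<le> card I" for k
    using that by blast
  define p where "p = (\<Prod>i\<in>I. [:- y i, 1:])"
  have deg: "degree p \<le> card I"
    using degree_prod_sum_le[OF assms(1), of "\<lambda>i. [:- y i, 1:]"] by (simp add: p_def)
  have "(\<Sum>i\<in>insert j I. c i * poly p (y i))
      = (\<Sum>i\<in>insert j I. \<Sum>k\<le>degree p. coeff p k * (c i * y i ^ k))"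
    by (simp add: poly_altdef sum_distrib_left mult_ac)
  also have "\<dots> = (\<Sum>k\<le>degree p. coeff p k * (\<Sum>i\<in>insert j I. c i * y i ^ k))"
    by (subst sum.swap) (simp add: sum_distrib_left)
  also have "\<dots> = 0"
    using zero deg by (intro sum.neutral) auto
  finally have "(\<Sum>i\<in>insert j I. c i * poly p (y i)) = 0" .
  moreover have "poly p (y i) = 0" if "i \<in> I" for i
    using that assms(1) by (auto simp: p_def poly_prod)
  ultimately have "c j * poly p (y j) = 0"
    using assms(1,2) by simp
  moreover have "poly p (y j) \<noteq> 0"
    using assms(1,3) by (auto simp: p_def poly_prod)
  ultimately show False using assms(4) by simp
qed

text \<open>Each differentiation in the weight \<open>w\<close> brings down one more factor \<open>y i\<close>. At \<open>w = 0\<close> all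
arguments of the derivative coincide, and it can be factored out.\<close>

lemma moment_times_derivative_eq_0:
  fixes f :: "real \<Rightarrow> real"
  assumes "C_k n f" and "k \<le> n"
    and "\<And>w. (\<Sum>i\<in>I. c i * f (w * y i + s)) = 0"
  shows "(\<Sum>i\<in>I. c i * y i ^ k) * (deriv ^^ k) f s = 0"
proof -
  have "(\<Sum>i\<in>I. c i * y i ^ k * (deriv ^^ k) f (w * y i + s)) = 0" for w
    using assms(2)
  proof (induction k arbitrary: w)
    case 0
    then show ?case using assms(3) by simp
  next
    case (Suc k)
    have "(deriv ^^ k) f differentiable (at x)" for x
      using assms(1) Suc.prems by (auto simp: C_k_def differentiable_on_def)
    then have D: "((deriv ^^ k) f has_field_derivative (deriv ^^ Suc k) f x) (at x)" for x
      by (simp add: DERIV_deriv_iff_real_differentiable)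
    have "((\<lambda>w. \<Sum>i\<in>I. c i * y i ^ k * (deriv ^^ k) f (w * y i + s)) has_real_derivative
        (\<Sum>i\<in>I. c i * y i ^ k * ((deriv ^^ Suc k) f (w * y i + s) * y i))) (at w)"
      by (intro DERIV_sum DERIV_cmult DERIV_chain2[OF D]) (auto intro!: derivative_eq_intros)
    moreover have "(\<lambda>w. \<Sum>i\<in>I. c i * y i ^ k * (deriv ^^ k) f (w * y i + s)) = (\<lambda>_. 0)"
      using Suc by (simp add: fun_eq_iff)
    ultimately have "((\<lambda>w. 0) has_real_derivative
        (\<Sum>i\<in>I. c i * y i ^ k * ((deriv ^^ Suc k) f (w * y i + s) * y i))) (at w)"
      by (simp only:)
    from DERIV_unique[OF this DERIV_const] show ?case by (simp add: mult_ac)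
  qed
  from this[of 0] show ?thesis by (simp add: sum_distrib_right)
qed

lemma poly_antiderivative:
  fixes q :: "real poly" and F :: "real \<Rightarrow> real"
  assumes "\<And>x. (F has_field_derivative poly q x) (at x)"
  shows "\<exists>p. degree p \<le> Suc (degree q) \<and> F = poly p"
proof -
  define r where "r = (\<Sum>i\<le>degree q. monom (coeff q i / real (Suc i)) (Suc i))"
  have deg: "degree r \<le> Suc (degree q)"
    unfolding r_def by (intro degree_sum_le) (auto intro: order.trans[OF degree_monom_le])
  have "coeff r (Suc k) = (if k \<le> degree q then coeff q k / real (Suc k) else 0)" for k
    by (simp add: r_def coeff_sum)
  then have "pderiv r = q"
    by (intro poly_eqI) (auto simp: coeff_pderiv coeff_eq_0)
  then have "((\<lambda>x. F x - poly r x) has_field_derivative 0) (at x)" for x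
    using DERIV_diff[OF assms poly_DERIV[of r]] by simp
  then have "F x - poly r x = F 0 - poly r 0" for x
    using DERIV_isconst_all by blast
  then have "F = poly (r + [:F 0 - poly r 0:])"
    by (auto simp: fun_eq_iff algebra_simps)
  moreover have "degree (r + [:F 0 - poly r 0:]) \<le> Suc (degree q)"
    using deg by (intro degree_add_le) auto
  ultimately show ?thesis by blast
qed

text \<open>What matters is that a polynomial of bounded degree depends linearly on its values at finitely
many nodes; the natural numbers are a convenient choice of nodes.\<close>

lemma lagrange_interpolation_at_naturals:
  fixes n :: nat
  shows "\<exists>l :: nat \<Rightarrow> real poly. (\<forall>j. degree (l j) \<le> n) \<and>
    (\<forall>p. degree p \<le> n \<longrightarrow> p = (\<Sum>j\<le>n. Polynomial.smult (poly p (real j)) (l j)))"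
proof -
  define P where "P j = (\<Prod>i\<in>{..n} - {j}. [:- real i, 1:])" for j
  define l where "l j = (if j \<le> n then Polynomial.smult (inverse (poly (P j) (real j))) (P j) else 0)" for j
  have degP: "degree (P j) \<le> n" if "j \<le> n" for j
    using degree_prod_sum_le[of "{..n} - {j}" "\<lambda>i. [:- real i, 1:]"] that
    by (simp add: P_def)
  have val: "poly (l j) (real i) = (if i = j then 1 else 0)" if "i \<le> n" "j \<le> n" for i j
    using that by (auto simp: l_def P_def poly_prod)
  have deg: "degree (l j) \<le> n" for j
    using degP by (auto simp: l_def)
  have "p = (\<Sum>j\<le>n. Polynomial.smult (poly p (real j)) (l j))" if p: "degree p \<le> n" for p
  proof (rule poly_eqI_degree)
    show "poly p x = poly (\<Sum>j\<le>n. Polynomial.smult (poly p (real j)) (l j)) x" if x: "x \<in> real ` {..n}" for x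
    proof -
      obtain i where i: "x = real i" "i \<le> n" using x by auto
      have "poly (\<Sum>j\<le>n. Polynomial.smult (poly p (real j)) (l j)) x
          = (\<Sum>j\<le>n. if i = j then poly p x else 0)"
        unfolding poly_sum using i val by (intro sum.cong) auto
      then show ?thesis using i by simp
    qed
    have c: "card (real ` {..n}) = Suc n" by (simp add: card_image inj_on_def)
    show "card (real ` {..n}) > degree p" using c p by simp
    have "degree (\<Sum>j\<le>n. Polynomial.smult (poly p (real j)) (l j)) \<le> n"
      using deg by (intro degree_sum_le) auto
    then show "card (real ` {..n}) > degree (\<Sum>j\<le>n. Polynomial.smult (poly p (real j)) (l j))"
      using c by simp
  qed
  with deg show ?thesis by blast
qed

text \<open>Convergence at the \<open>n + 1\<close> interpolation nodes determines the limit everywhere, because the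
interpolation formula passes to the limit.\<close>

lemma pointwise_limit_of_polys_of_bounded_degree:
  fixes f :: "real \<Rightarrow> real"
  assumes "\<And>t. degree (p t) \<le> n" and "\<And>x. ((\<lambda>t. poly (p t) x) \<longlongrightarrow> f x) F"
    and "F \<noteq> bot"
  shows "\<exists>q. degree q \<le> n \<and> f = poly q"
proof -
  obtain l :: "nat \<Rightarrow> real poly" where deg: "\<And>j. degree (l j) \<le> n"
    and l: "\<And>p. degree p \<le> n \<Longrightarrow> p = (\<Sum>j\<le>n. Polynomial.smult (poly p (real j)) (l j))"
    using lagrange_interpolation_at_naturals[of n] by blast
  define q where "q = (\<Sum>j\<le>n. Polynomial.smult (f (real j)) (l j))"
  have "f x = poly q x" for x
  proof (rule tendsto_unique[OF assms(3,2)])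
    have "((\<lambda>t. \<Sum>j\<le>n. poly (p t) (real j) * poly (l j) x) \<longlongrightarrow> poly q x) F"
      unfolding q_def poly_sum poly_smult by (intro tendsto_intros assms(2))
    moreover have "(\<lambda>t. poly (p t) x) = (\<lambda>t. \<Sum>j\<le>n. poly (p t) (real j) * poly (l j) x)"
      by (subst l[OF assms(1)]) (simp add: poly_sum)
    ultimately show "((\<lambda>t. poly (p t) x) \<longlongrightarrow> poly q x) F" by simp
  qed
  moreover have "degree q \<le> n"
    unfolding q_def using deg by (intro degree_sum_le) auto
  ultimately show ?thesis by blast
qed

text \<open>For smooth \<open>f\<close>, differentiating \<open>k\<close> times in \<open>w\<close> at \<open>w = 0\<close> would show that the \<open>k\<close>-th derivative
of \<open>f\<close> is zero. For \<open>f\<close> merely continuous, the induction step from \<open>k\<close> to \<open>Suc k\<close> uses an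
antiderivative \<open>G\<close> of \<open>f\<close>. The increment \<open>x \<mapsto> G (x + d) - G x\<close> inherits the relation, and
differentiating it in \<open>w\<close> gives a relation for \<open>x \<mapsto> f (x + d) - f x\<close> with the coefficients
\<open>c i * y i\<close>, whose moment of order \<open>k\<close> is the moment of order \<open>Suc k\<close> of \<open>c\<close>. By induction this
difference is a polynomial, hence so is the increment of \<open>G\<close>; and \<open>f\<close> is the limit of the
difference quotients of \<open>G\<close>, polynomials of bounded degree.\<close>

lemma polynomial_of_ridge_relation:
  fixes f :: "real \<Rightarrow> real"
  assumes "continuous_on UNIV f" and "(\<Sum>i\<in>I. c i * y i ^ k) \<noteq> 0"
    and "\<And>w b. (\<Sum>i\<in>I. c i * f (w * y i + b)) = 0"
  shows "\<exists>p. degree p \<le> k \<and> f = poly p"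
  using assms
proof (induction k arbitrary: f c)
  case 0
  have "f b = 0" for b
    using "0.prems"(3)[of 0 b] "0.prems"(2) by (simp flip: sum_distrib_right)
  then show ?case by (intro exI[of _ 0]) (simp add: fun_eq_iff)
next
  case (Suc k)
  obtain G where G: "(G has_field_derivative f x) (at x)" for x
    using einterval_antiderivative[of "-\<infinity>" "\<infinity>" f] Suc.prems(1)
    by (auto simp: has_real_derivative_iff_has_vector_derivative continuous_on_eq_continuous_at)
  define F where "F d x = G (x + d) - G x" for d x
  have F': "(F d has_field_derivative (f (x + d) - f x)) (at x)" for d x
    unfolding F_def using DERIV_diff[OF DERIV_shift[THEN iffD1, OF G] G] .
  have rel_F: "(\<Sum>i\<in>I. c i * F d (w * y i + b)) = 0" for d w b
  proof -
    \<comment> \<open>Integrating the relation for \<open>f\<close> in \<open>b\<close> yields a constant, which cancels in the increment.\<close>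
    let ?K = "\<lambda>b. \<Sum>i\<in>I. c i * G (w * y i + b)"
    have "(?K has_field_derivative (\<Sum>i\<in>I. c i * (f (w * y i + b) * 1))) (at b)" for b
      by (intro DERIV_sum DERIV_cmult DERIV_chain2[OF G]) (auto intro!: derivative_eq_intros)
    then have "(?K has_field_derivative 0) (at b)" for b
      using Suc.prems(3) by simp
    then have "?K (b + d) = ?K b"
      using DERIV_isconst_all by blast
    then show ?thesis
      by (simp add: F_def sum_subtractf right_diff_distrib add.assoc)
  qed
  have poly_F: "\<exists>p. degree p \<le> Suc k \<and> F d = poly p" for d
  proof -
    let ?D = "\<lambda>x. f (x + d) - f x"
    have "(\<Sum>i\<in>I. (c i * y i) * ?D (w * y i + b)) = 0" for w b
    proof -
      have "((\<lambda>w. \<Sum>i\<in>I. c i * F d (w * y i + b)) has_field_derivative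
          (\<Sum>i\<in>I. c i * (?D (w * y i + b) * y i))) (at w)"
        by (intro DERIV_sum DERIV_cmult DERIV_chain2[OF F']) (auto intro!: derivative_eq_intros)
      then have "(\<Sum>i\<in>I. c i * (?D (w * y i + b) * y i)) = 0"
        using DERIV_unique DERIV_const unfolding rel_F by blast
      then show ?thesis by (simp add: mult_ac)
    qed
    moreover have "(\<Sum>i\<in>I. (c i * y i) * y i ^ k) \<noteq> 0"
      using Suc.prems(2) by (simp add: mult_ac)
    moreover have "continuous_on UNIV ?D"
      by (intro continuous_intros continuous_on_compose2[OF Suc.prems(1)]) auto
    ultimately obtain q where q: "degree q \<le> k" "?D = poly q"
      using Suc.IH[of ?D "\<lambda>i. c i * y i"] by blast
    then have "(F d has_field_derivative poly q x) (at x)" for x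
      using F'[of d x] by (metis (mono_tags, lifting))
    from poly_antiderivative[OF this] q(1) show ?thesis
      by (meson Suc_le_mono order.trans)
  qed
  then obtain P where P: "\<And>d. degree (P d) \<le> Suc k" "\<And>d. F d = poly (P d)"
    by metis
  show ?case
  proof (rule pointwise_limit_of_polys_of_bounded_degree)
    show "degree (Polynomial.smult (inverse d) (P d)) \<le> Suc k" for d
      using P(1)[of d] degree_smult_le order.trans by blast
    show "((\<lambda>d. poly (Polynomial.smult (inverse d) (P d)) x) \<longlongrightarrow> f x) (at 0)" for x
      using G[of x] by (simp add: DERIV_def F_def divide_inverse mult.commute flip: P(2))
  qed simp
qed

text \<open>The ridge functions \<open>y \<mapsto> \<sigma> (w * y + b)\<close> separate one node from the others. A nonzero
moment of the coefficients turns a relation between their values into a statement about \<open>\<sigma>\<close> itself: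
\<open>\<sigma>\<close> is a polynomial, or one of its derivatives vanishes at \<open>s\<close>. The moment has order at most
\<open>card I\<close>, which is why that many derivatives suffice.\<close>

lemma no_nontrivial_ridge_relation:
  fixes \<sigma> :: "real \<Rightarrow> real"
  assumes "finite I" and "j \<notin> I" and "y j \<notin> y ` I" and "c j \<noteq> 0"
    and rel: "\<And>w b. (\<Sum>i\<in>insert j I. c i * \<sigma> (w * y i + b)) = 0"
    and activation: "(continuous_on UNIV \<sigma> \<and> \<not> polynomial_fun \<sigma>) \<or>
      (C_k (card I) \<sigma> \<and> (\<exists>s. \<forall>k\<le>card I. (deriv ^^ k) \<sigma> s \<noteq> 0))"
  shows False
proof -
  obtain k where k: "k \<le> card I" "(\<Sum>i\<in>insert j I. c i * y i ^ k) \<noteq> 0"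
    using exists_nonzero_moment[of I j y c] assms(1-4) by blast
  from activation show False
  proof
    assume "continuous_on UNIV \<sigma> \<and> \<not> polynomial_fun \<sigma>"
    then show False
      using polynomial_of_ridge_relation[of \<sigma> c y k "insert j I"] k(2) rel
      by (auto simp: polynomial_fun_def)
  next
    assume "C_k (card I) \<sigma> \<and> (\<exists>s. \<forall>k\<le>card I. (deriv ^^ k) \<sigma> s \<noteq> 0)"
    then obtain s where "C_k (card I) \<sigma>" "(deriv ^^ k) \<sigma> s \<noteq> 0" using k(1) by blast
    then show False
      using moment_times_derivative_eq_0[of "card I" \<sigma> k c y s "insert j I"] k rel by auto
  qed
qed

section \<open>Networks as a vector space of functions\<close>

text \<open>The functions that can occur as an entry of \<open>W *\<^sub>v y + b\<close>, where \<open>y\<close> is the output of layer \<open>i\<close>.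
The recursion mentions neither widths nor matrices, so closure under linear combinations, which
for networks means stacking layers of different widths, is immediate. Combining over a finite
set of functions loses nothing, since equal neurons can be merged.\<close>

fun preactivations :: "(real \<Rightarrow> real) \<Rightarrow> nat \<Rightarrow> (real ^ 'n \<Rightarrow> real) set" where
  "preactivations \<sigma> 0 = {\<lambda>x. (\<Sum>k\<in>UNIV. a k * vec_nth x k) + t | a t. True}"
| "preactivations \<sigma> (Suc i) =
     {\<lambda>x. (\<Sum>h\<in>S. a h * \<sigma> (h x)) + t | S a t. finite S \<and> S \<subseteq> preactivations \<sigma> i}"

lemma preactivations_0I: "(\<lambda>x. (\<Sum>k\<in>UNIV. a k * vec_nth x k) + t) \<in> preactivations \<sigma> 0"
  by auto

lemma preactivations_SucI:
  "finite S \<Longrightarrow> S \<subseteq> preactivations \<sigma> i \<Longrightarrow>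
    (\<lambda>x. (\<Sum>h\<in>S. a h * \<sigma> (h x)) + t) \<in> preactivations \<sigma> (Suc i)"
  by auto

declare preactivations.simps [simp del]

lemma preactivations_affine:
  assumes "u \<in> preactivations \<sigma> i"
  shows "(\<lambda>x. s * u x + r) \<in> preactivations \<sigma> i"
proof (cases i)
  case 0
  then obtain a t where u: "u = (\<lambda>x. (\<Sum>k\<in>UNIV. a k * vec_nth x k) + t)"
    using assms by (auto simp: preactivations.simps)
  have "(\<lambda>x. s * u x + r) = (\<lambda>x. (\<Sum>k\<in>UNIV. (s * a k) * vec_nth x k) + (s * t + r))"
    by (simp add: u algebra_simps sum_distrib_left)
  also have "\<dots> \<in> preactivations \<sigma> 0"
    by (rule preactivations_0I)
  finally show ?thesis using 0 by simp
next
  case (Suc j)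
  then obtain S a t where u: "u = (\<lambda>x. (\<Sum>h\<in>S. a h * \<sigma> (h x)) + t)"
    and S: "finite S" "S \<subseteq> preactivations \<sigma> j"
    using assms by (auto simp: preactivations.simps)
  have "(\<lambda>x. s * u x + r) = (\<lambda>x. (\<Sum>h\<in>S. (s * a h) * \<sigma> (h x)) + (s * t + r))"
    by (simp add: u algebra_simps sum_distrib_left)
  also have "\<dots> \<in> preactivations \<sigma> (Suc j)"
    by (rule preactivations_SucI[OF S])
  finally show ?thesis using Suc by simp
qed

lemma preactivations_add:
  assumes "u \<in> preactivations \<sigma> i" and "v \<in> preactivations \<sigma> i"
  shows "(\<lambda>x. u x + v x) \<in> preactivations \<sigma> i"
proof (cases i)
  case 0
  then obtain a t a' t' where u: "u = (\<lambda>x. (\<Sum>k\<in>UNIV. a k * vec_nth x k) + t)"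
    and v: "v = (\<lambda>x. (\<Sum>k\<in>UNIV. a' k * vec_nth x k) + t')"
    using assms by (auto simp: preactivations.simps)
  have "(\<lambda>x. u x + v x) = (\<lambda>x. (\<Sum>k\<in>UNIV. (a k + a' k) * vec_nth x k) + (t + t'))"
    by (simp add: u v algebra_simps sum.distrib)
  also have "\<dots> \<in> preactivations \<sigma> 0"
    by (rule preactivations_0I)
  finally show ?thesis using 0 by simp
next
  case (Suc j)
  obtain S a t where u: "u = (\<lambda>x. (\<Sum>h\<in>S. a h * \<sigma> (h x)) + t)"
    and S: "finite S" "S \<subseteq> preactivations \<sigma> j"
    using assms(1) Suc by (auto simp: preactivations.simps)
  obtain S' a' t' where v: "v = (\<lambda>x. (\<Sum>h\<in>S'. a' h * \<sigma> (h x)) + t')"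
    and S': "finite S'" "S' \<subseteq> preactivations \<sigma> j"
    using assms(2) Suc by (auto simp: preactivations.simps)
  let ?e = "\<lambda>h. if h \<in> S then a h else 0" and ?e' = "\<lambda>h. if h \<in> S' then a' h else 0"
  have "(\<Sum>h\<in>S. a h * \<sigma> (h x)) = (\<Sum>h\<in>S \<union> S'. ?e h * \<sigma> (h x))" for x
    using S(1) S'(1) by (intro sum.mono_neutral_cong_left) auto
  moreover have "(\<Sum>h\<in>S'. a' h * \<sigma> (h x)) = (\<Sum>h\<in>S \<union> S'. ?e' h * \<sigma> (h x))" for x
    using S(1) S'(1) by (intro sum.mono_neutral_cong_left) auto
  ultimately have
    "(\<lambda>x. u x + v x) = (\<lambda>x. (\<Sum>h\<in>S \<union> S'. (?e h + ?e' h) * \<sigma> (h x)) + (t + t'))"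
    by (simp add: u v distrib_right sum.distrib add_ac)
  also have "\<dots> \<in> preactivations \<sigma> (Suc j)"
    using S S' by (intro preactivations_SucI) auto
  finally show ?thesis using Suc by simp
qed

lemma preactivations_const: "(\<lambda>x. t) \<in> preactivations \<sigma> i"
  using preactivations_0I[of "\<lambda>_. 0" t \<sigma>] preactivations_SucI[of "{}" \<sigma> "i - 1" "\<lambda>_. 0" t]
  by (cases i) simp_all

lemma preactivations_sum:
  assumes "finite I" and "\<And>j. j \<in> I \<Longrightarrow> u j \<in> preactivations \<sigma> i"
  shows "(\<lambda>x. \<Sum>j\<in>I. c j * u j x) \<in> preactivations \<sigma> i"
  using assms
proof (induction I rule: finite_induct)
  case empty
  then show ?case using preactivations_const[of 0] by simp
next
  case (insert j I)
  have "(\<lambda>x. c j * u j x) \<in> preactivations \<sigma> i"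
    using preactivations_affine[of "u j" \<sigma> i "c j" 0] insert.prems by simp
  then show ?case
    using insert preactivations_add[of "\<lambda>x. c j * u j x" \<sigma> i "\<lambda>x. \<Sum>j\<in>I. c j * u j x"] by simp
qed

lemma preactivations_coordinate: "(\<lambda>x. vec_nth x k) \<in> preactivations \<sigma> 0"
  using preactivations_0I[of "\<lambda>j. if j = k then 1 else 0" 0 \<sigma>] by (simp add: mult_delta_left)

lemma preactivations_activated:
  assumes "h \<in> preactivations \<sigma> i"
  shows "(\<lambda>x. \<sigma> (h x)) \<in> preactivations \<sigma> (Suc i)"
  using preactivations_SucI[of "{h}" \<sigma> i "\<lambda>_. 1" 0] assms by simp

lemma affine_map_index:
  assumes "A \<in> carrier_mat m k" and "y \<in> carrier_vec k" and "b \<in> carrier_vec m" and "r < m"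
  shows "vec_index (A *\<^sub>v y + b) r =
    (\<Sum>j<k. index_mat A (r, j) * vec_index y j) + vec_index b r"
  using assms by (simp add: scalar_prod_def atLeast0LessThan)

lemma nn_layer_carrier:
  assumes "y \<in> carrier_vec (w 0)"
    and "\<And>j. j \<in> {1..i} \<Longrightarrow> W j \<in> carrier_mat (w j) (w (j - 1)) \<and> b j \<in> carrier_vec (w j)"
  shows "nn_layer \<sigma> W b y i \<in> carrier_vec (w i)"
proof (cases i)
  case (Suc k)
  then have "dim_vec (b (Suc k)) = w (Suc k)" using assms(2)[of i] by simp
  then show ?thesis unfolding Suc by (intro carrier_vecI) simp
qed (use assms(1) in simp)

lemma nn_layer_cong:
  assumes "\<And>j. j \<in> {1..i} \<Longrightarrow> W j = W' j \<and> b j = b' j"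
  shows "nn_layer \<sigma> W b y i = nn_layer \<sigma> W' b' y i"
  using assms by (induction i) auto

lemma coordinates_carrier: "coordinates x \<in> carrier_vec CARD('n)"
  for x :: "real ^ 'n"
  by (simp add: coordinates_def)

lemma affine_map_nn_layer_in_preactivations:
  fixes w :: "nat \<Rightarrow> nat"
  assumes "w 0 = CARD('n)"
    and "\<And>j. j \<in> {1..Suc i} \<Longrightarrow> W j \<in> carrier_mat (w j) (w (j - 1)) \<and> b j \<in> carrier_vec (w j)"
    and "r < w (Suc i)"
  shows "(\<lambda>x :: real ^ 'n. vec_index (W (Suc i) *\<^sub>v nn_layer \<sigma> W b (coordinates x) i + b (Suc i)) r)
    \<in> preactivations \<sigma> i"
  using assms(2,3)
proof (induction i arbitrary: r)
  case 0
  have "(\<lambda>x :: real ^ 'n. vec_index (coordinates x) j) \<in> preactivations \<sigma> 0" if "j < CARD('n)" for j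
    using that preactivations_coordinate by (simp add: coordinates_def)
  then have "(\<lambda>x :: real ^ 'n. \<Sum>j<CARD('n). index_mat (W 1) (r, j) * vec_index (coordinates x) j)
      \<in> preactivations \<sigma> 0"
    by (intro preactivations_sum) auto
  from preactivations_affine[OF this, of 1 "vec_index (b 1) r"]
  have "(\<lambda>x :: real ^ 'n. (\<Sum>j<CARD('n). index_mat (W 1) (r, j) * vec_index (coordinates x) j)
      + vec_index (b 1) r) \<in> preactivations \<sigma> 0"
    by simp
  moreover have "vec_index (W 1 *\<^sub>v coordinates x + b 1) r =
      (\<Sum>j<CARD('n). index_mat (W 1) (r, j) * vec_index (coordinates x) j) + vec_index (b 1) r"
    for x :: "real ^ 'n"
    using "0.prems"(1)[of 1] "0.prems"(2) assms(1) coordinates_carrier[of x]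
    by (intro affine_map_index) auto
  ultimately show ?case by simp
next
  case (Suc i)
  let ?y = "\<lambda>x :: real ^ 'n. nn_layer \<sigma> W b (coordinates x) (Suc i)"
  have y: "?y x \<in> carrier_vec (w (Suc i))" for x
    using Suc.prems(1) assms(1) coordinates_carrier by (intro nn_layer_carrier) auto
  have "(\<lambda>x. vec_index (?y x) j) \<in> preactivations \<sigma> (Suc i)" if j: "j < w (Suc i)" for j
  proof -
    have "b (Suc i) \<in> carrier_vec (w (Suc i))" using Suc.prems(1) by simp
    then have "vec_index (?y x) j =
      \<sigma> (vec_index (W (Suc i) *\<^sub>v nn_layer \<sigma> W b (coordinates x) i + b (Suc i)) j)" for x
      using j by simp
    moreover have "(\<lambda>x :: real ^ 'n. vec_index
        (W (Suc i) *\<^sub>v nn_layer \<sigma> W b (coordinates x) i + b (Suc i)) j) \<in> preactivations \<sigma> i"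
      using Suc.prems(1) j by (intro Suc.IH) auto
    ultimately show ?thesis using preactivations_activated by fastforce
  qed
  then have "(\<lambda>x. \<Sum>j<w (Suc i). index_mat (W (Suc (Suc i))) (r, j) * vec_index (?y x) j)
      \<in> preactivations \<sigma> (Suc i)"
    by (intro preactivations_sum) auto
  from preactivations_affine[OF this, of 1 "vec_index (b (Suc (Suc i))) r"]
  have "(\<lambda>x. (\<Sum>j<w (Suc i). index_mat (W (Suc (Suc i))) (r, j) * vec_index (?y x) j)
      + vec_index (b (Suc (Suc i))) r) \<in> preactivations \<sigma> (Suc i)"
    by simp
  moreover have "vec_index (W (Suc (Suc i)) *\<^sub>v ?y x + b (Suc (Suc i))) r =
      (\<Sum>j<w (Suc i). index_mat (W (Suc (Suc i))) (r, j) * vec_index (?y x) j)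
      + vec_index (b (Suc (Suc i))) r" for x
    using Suc.prems(1)[of "Suc (Suc i)"] Suc.prems(2) y by (intro affine_map_index) auto
  ultimately show ?case by (simp only:)
qed

text \<open>Finitely many functions, rather than one, must be realized by a common network for the induction
to go through: the neurons needed for the individual functions are collected in one hidden layer,
and unused neurons get the weight 0.\<close>

lemma preactivations_realized_jointly:
  fixes gs :: "(real ^ 'n \<Rightarrow> real) list"
  assumes "gs \<noteq> []" and "set gs \<subseteq> preactivations \<sigma> i"
  shows "\<exists>W b. \<exists>w :: nat \<Rightarrow> nat. w 0 = CARD('n) \<and> w (Suc i) = length gs \<and>
    (\<forall>j\<in>{1..Suc i}. w j \<ge> 1 \<and> W j \<in> carrier_mat (w j) (w (j - 1)) \<and> b j \<in> carrier_vec (w j)) \<and>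
    (\<forall>x. \<forall>r<length gs.
      vec_index (W (Suc i) *\<^sub>v nn_layer \<sigma> W b (coordinates x) i + b (Suc i)) r = (gs ! r) x)"
  using assms
proof (induction i arbitrary: gs)
  case 0
  have "\<exists>a t. gs ! r = (\<lambda>x. (\<Sum>k\<in>UNIV. a k * vec_nth x k) + t)" if "r < length gs" for r
    using "0.prems"(2) nth_mem[OF that] by (auto simp: preactivations.simps)
  then obtain a t where
    at: "\<And>r. r < length gs \<Longrightarrow> gs ! r = (\<lambda>x. (\<Sum>k\<in>UNIV. a r k * vec_nth x k) + t r)"
    by metis
  define W where "W = (\<lambda>_ :: nat. Matrix.mat (length gs) CARD('n)
    (\<lambda>(r, j). a r (from_nat_into UNIV j)))"
  define b where "b = (\<lambda>_ :: nat. Matrix.vec (length gs) t)"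
  define w where "w = (\<lambda>j :: nat. if j = 0 then CARD('n) else length gs)"
  have "vec_index (W 1 *\<^sub>v coordinates x + b 1) r = (gs ! r) x" if r: "r < length gs" for x r
  proof -
    have "vec_index (W 1 *\<^sub>v coordinates x + b 1) r =
        (\<Sum>j<CARD('n). index_mat (W 1) (r, j) * vec_index (coordinates x) j) + vec_index (b 1) r"
      using r coordinates_carrier by (intro affine_map_index) (auto simp: W_def b_def)
    also have "\<dots> = (\<Sum>j<CARD('n). a r (from_nat_into UNIV j) * vec_nth x (from_nat_into UNIV j)) + t r"
      using r by (simp add: W_def b_def coordinates_def)
    also have "\<dots> = (\<Sum>k\<in>UNIV. a r k * vec_nth x k) + t r"
      using sum.reindex_bij_betw[OF bij_betw_from_nat_into_finite[OF finite[of "UNIV :: 'n set"]],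
          of "\<lambda>k. a r k * vec_nth x k"]
      by simp
    finally show ?thesis using at[OF r] by simp
  qed
  then show ?case
    using "0.prems"(1)
    by (intro exI[of _ W] exI[of _ b] exI[of _ w]) (auto simp: w_def W_def b_def Suc_le_eq)
next
  case (Suc i)
  have "\<exists>S a t. gs ! r = (\<lambda>x. (\<Sum>h\<in>S. a h * \<sigma> (h x)) + t) \<and> finite S \<and> S \<subseteq> preactivations \<sigma> i"
    if "r < length gs" for r
    using Suc.prems(2) nth_mem[OF that] by (auto simp: preactivations.simps)
  then have "\<forall>r. r < length gs \<longrightarrow> (\<exists>S a t. gs ! r = (\<lambda>x. (\<Sum>h\<in>S. a h * \<sigma> (h x)) + t) \<and>
      finite S \<and> S \<subseteq> preactivations \<sigma> i)"
    by blast
  then obtain S a t where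
    at: "\<And>r. r < length gs \<Longrightarrow> gs ! r = (\<lambda>x. (\<Sum>h\<in>S r. a r h * \<sigma> (h x)) + t r)" and
    S: "\<And>r. r < length gs \<Longrightarrow> finite (S r) \<and> S r \<subseteq> preactivations \<sigma> i"
    unfolding choice_iff' by blast
  \<comment> \<open>The zero function is added so that the new hidden layer has positive width.\<close>
  define T where "T = insert (\<lambda>_. 0) (\<Union>r<length gs. S r)"
  have "finite T" using S by (auto simp: T_def)
  then obtain hs where hs: "set hs = T" "distinct hs"
    using finite_distinct_list by blast
  have "hs \<noteq> []" and "set hs \<subseteq> preactivations \<sigma> i"
    using hs(1) S preactivations_const[of 0] by (auto simp: T_def)
  from Suc.IH[OF this] obtain W b and w :: "nat \<Rightarrow> nat" where
    w: "w 0 = CARD('n)" "w (Suc i) = length hs" and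
    dims: "\<And>j. j \<in> {1..Suc i} \<Longrightarrow>
      w j \<ge> 1 \<and> W j \<in> carrier_mat (w j) (w (j - 1)) \<and> b j \<in> carrier_vec (w j)" and
    val: "\<And>x r. r < length hs \<Longrightarrow>
      vec_index (W (Suc i) *\<^sub>v nn_layer \<sigma> W b (coordinates x) i + b (Suc i)) r = (hs ! r) x"
    by blast
  define A where "A = Matrix.mat (length gs) (length hs)
    (\<lambda>(r, j). if hs ! j \<in> S r then a r (hs ! j) else 0)"
  define W' where "W' = W(Suc (Suc i) := A)"
  define b' where "b' = b(Suc (Suc i) := Matrix.vec (length gs) t)"
  define w' where "w' = w(Suc (Suc i) := length gs)"
  have dims': "w' j \<ge> 1 \<and> W' j \<in> carrier_mat (w' j) (w' (j - 1)) \<and> b' j \<in> carrier_vec (w' j)"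
    if "j \<in> {1..Suc (Suc i)}" for j
  proof (cases "j = Suc (Suc i)")
    case True
    then show ?thesis
      using Suc.prems(1) w by (simp add: W'_def b'_def w'_def A_def Suc_le_eq)
  next
    case False
    then show ?thesis
      using that dims[of j] by (auto simp: W'_def b'_def w'_def)
  qed
  have "vec_index (W' (Suc (Suc i)) *\<^sub>v nn_layer \<sigma> W' b' (coordinates x) (Suc i) + b' (Suc (Suc i))) r
      = (gs ! r) x" if r: "r < length gs" for x r
  proof -
    let ?y = "nn_layer \<sigma> W b (coordinates x) (Suc i)"
    have y': "nn_layer \<sigma> W' b' (coordinates x) (Suc i) = ?y"
      by (rule nn_layer_cong) (auto simp: W'_def b'_def)
    have y: "?y \<in> carrier_vec (length hs)"
      using nn_layer_carrier[of "coordinates x" w "Suc i" W b \<sigma>] dims w coordinates_carrier[of x]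
      by simp
    have yj: "vec_index ?y j = \<sigma> ((hs ! j) x)" if j: "j < length hs" for j
      using val[OF j, of x] j w dims[of "Suc i"] by auto
    have "vec_index (W' (Suc (Suc i)) *\<^sub>v ?y + b' (Suc (Suc i))) r
        = (\<Sum>j<length hs. index_mat A (r, j) * vec_index ?y j) + t r"
      using affine_map_index[of A "length gs" "length hs" ?y "Matrix.vec (length gs) t" r] r y
      by (simp add: W'_def b'_def A_def)
    also have "(\<Sum>j<length hs. index_mat A (r, j) * vec_index ?y j) =
        (\<Sum>j<length hs. (\<lambda>h. (if h \<in> S r then a r h else 0) * \<sigma> (h x)) (hs ! j))"
      using r yj by (intro sum.cong) (auto simp: A_def)
    also have "\<dots> = (\<Sum>h\<in>T. (if h \<in> S r then a r h else 0) * \<sigma> (h x))"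
      by (rule sum.reindex_bij_betw[OF bij_betw_nth[OF hs(2) refl hs(1)[symmetric]]])
    also have "\<dots> = (\<Sum>h\<in>S r. a r h * \<sigma> (h x))"
      using \<open>finite T\<close> r by (intro sum.mono_neutral_cong_right) (auto simp: T_def)
    finally show ?thesis using at[OF r] y' by simp
  qed
  moreover have "w' 0 = CARD('n)" "w' (Suc (Suc i)) = length gs"
    using w by (simp_all add: w'_def)
  ultimately show ?case using dims' by blast
qed

text \<open>The output layer is not activated, so a network of depth \<open>Suc i\<close> is a preactivation over layer
\<open>i\<close>.\<close>

lemma neural_networks_eq_preactivations:
  "neural_networks \<sigma> (Suc i) = (preactivations \<sigma> i :: (real ^ 'n \<Rightarrow> real) set)"
proof (intro equalityI subsetI)
  fix f :: "real ^ 'n \<Rightarrow> real"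
  assume "f \<in> neural_networks \<sigma> (Suc i)"
  then obtain W b and w :: "nat \<Rightarrow> nat" where f: "f = nn_realization \<sigma> (Suc i) W b"
    and w: "w 0 = CARD('n)" "w (Suc i) = 1"
    and dims: "\<And>j. j \<in> {1..Suc i} \<Longrightarrow>
      W j \<in> carrier_mat (w j) (w (j - 1)) \<and> b j \<in> carrier_vec (w j)"
    unfolding neural_networks_def by blast
  have "(\<lambda>x :: real ^ 'n. vec_index (W (Suc i) *\<^sub>v nn_layer \<sigma> W b (coordinates x) i + b (Suc i)) 0)
      \<in> preactivations \<sigma> i"
    using w dims by (intro affine_map_nn_layer_in_preactivations[of w]) auto
  moreover have "f = (\<lambda>x. vec_index (W (Suc i) *\<^sub>v nn_layer \<sigma> W b (coordinates x) i + b (Suc i)) 0)"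
    by (simp add: f fun_eq_iff nn_realization_def)
  ultimately show "f \<in> preactivations \<sigma> i" by simp
next
  fix f :: "real ^ 'n \<Rightarrow> real"
  assume "f \<in> preactivations \<sigma> i"
  then obtain W b and w :: "nat \<Rightarrow> nat" where w: "w 0 = CARD('n)" "w (Suc i) = 1"
    and dims: "\<forall>j\<in>{1..Suc i}.
      w j \<ge> 1 \<and> W j \<in> carrier_mat (w j) (w (j - 1)) \<and> b j \<in> carrier_vec (w j)"
    and val: "\<And>x. vec_index (W (Suc i) *\<^sub>v nn_layer \<sigma> W b (coordinates x) i + b (Suc i)) 0 = f x"
    using preactivations_realized_jointly[of "[f]" \<sigma> i] by auto
  have "f = nn_realization \<sigma> (Suc i) W b"
    using val by (simp add: fun_eq_iff nn_realization_def)
  then show "f \<in> neural_networks \<sigma> (Suc i)"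
    unfolding neural_networks_def using w dims by fastforce
qed

section \<open>Functions with infinitely many values\<close>

lemma infinite_coordinate_image:
  fixes \<Omega> :: "(real ^ 'n) set"
  assumes "open \<Omega>" and "\<Omega> \<noteq> {}"
  shows "infinite ((\<lambda>x. vec_nth x k) ` \<Omega>)"
proof -
  have "open ((\<lambda>x. vec_nth x k) ` \<Omega>)"
    by (rule open_image_vec_nth[OF assms(1)])
  then show ?thesis
    using assms(2) finite_imp_not_open by blast
qed

text \<open>Width-one layers transport an infinite set of values as long as these stay in an invariant set
\<open>P\<close> on which the activation is injective. For the rectifier \<open>P\<close> is a half-line, for strictly
monotone activations the whole line.\<close>

lemma preactivations_infinite_image:
  fixes \<Omega> :: "(real ^ 'n) set"
  assumes "p \<in> preactivations \<sigma> 0" and "infinite (p ` \<Omega>)" and "p ` \<Omega> \<subseteq> P"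
    and "inj_on \<sigma> P" and "\<sigma> ` P \<subseteq> P"
  shows "\<exists>q\<in>preactivations \<sigma> i. infinite (q ` \<Omega>) \<and> q ` \<Omega> \<subseteq> P"
proof (induction i)
  case 0
  then show ?case using assms(1-3) by blast
next
  case (Suc i)
  then obtain q where q: "q \<in> preactivations \<sigma> i" "infinite (q ` \<Omega>)" "q ` \<Omega> \<subseteq> P"
    by blast
  have "infinite (\<sigma> ` q ` \<Omega>)"
    using q(2,3) assms(4) finite_imageD inj_on_subset by blast
  then show ?case
    using preactivations_activated[OF q(1)] q(3) assms(5)
    by (intro bexI[of _ "\<lambda>x. \<sigma> (q x)"]) (auto simp: image_image)
qed

text \<open>A single coordinate already takes infinitely many values on an open set. For the rectifier, it is
first shifted by a bound of \<open>\<Omega>\<close>, so that every layer acts on it as the identity.\<close>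

lemma exists_preactivation_with_infinite_image:
  fixes \<Omega> :: "(real ^ 'n) set"
  assumes "open \<Omega>" and "bounded \<Omega>" and "\<Omega> \<noteq> {}"
    and "\<sigma> = relu \<or> (i > 0 \<longrightarrow> strictly_monotone \<sigma>)"
  shows "\<exists>p\<in>preactivations \<sigma> i. infinite (p ` \<Omega>)"
proof -
  fix k :: 'n
  have inf: "infinite ((\<lambda>x. vec_nth x k) ` \<Omega>)"
    using infinite_coordinate_image assms(1,3) by blast
  consider "\<sigma> = relu" | "i = 0" | "strictly_monotone \<sigma>"
    using assms(4) by blast
  then show ?thesis
  proof cases
    case 1
    obtain B where B: "\<And>x. x \<in> \<Omega> \<Longrightarrow> norm x \<le> B"
      using assms(2) bounded_iff by blast
    let ?p = "\<lambda>x :: real ^ 'n. 1 * vec_nth x k + B"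
    have "?p \<in> preactivations \<sigma> 0"
      by (intro preactivations_affine preactivations_coordinate)
    moreover have "?p ` \<Omega> = (\<lambda>t. t + B) ` (\<lambda>x. vec_nth x k) ` \<Omega>"
      by (simp add: image_image)
    then have "infinite (?p ` \<Omega>)"
      using inf finite_imageD[of "\<lambda>t. t + B"] by (metis inj_on_def add_right_cancel)
    moreover have "?p ` \<Omega> \<subseteq> {0..}"
    proof (intro image_subsetI)
      fix x assume "x \<in> \<Omega>"
      with B[of x] component_le_norm_cart[of x k] show "?p x \<in> {0..}" by simp
    qed
    moreover have "inj_on \<sigma> {0..}" "\<sigma> ` {0..} \<subseteq> {0..}"
      using 1 by (auto simp: inj_on_def relu_def)
    ultimately show ?thesis
      using preactivations_infinite_image[of ?p \<sigma> \<Omega> "{0..}" i] by blast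
  next
    case 2
    then show ?thesis using inf preactivations_coordinate by blast
  next
    case 3
    then have "inj \<sigma>"
      unfolding strictly_monotone_def
      by (auto simp: monotone_on_def inj_def)
        (metis less_irrefl linorder_neqE_linordered_idom strict_monoD)+
    then show ?thesis
      using preactivations_infinite_image[of "\<lambda>x. vec_nth x k" \<sigma> \<Omega> UNIV i] inf preactivations_coordinate
      by blast
  qed
qed

section \<open>Networks vanishing on the grid, and infinitely many minimizers\<close>

text \<open>Otherwise the value at \<open>z\<close> of every network would be a fixed linear combination of its values on
\<open>\<Omega>h\<close>. Applied to the neurons \<open>\<sigma> (w * p x + b)\<close>, this is a ridge relation with nodes \<open>p x\<close>, and
\<open>z\<close> is chosen so that \<open>p z\<close> differs from the other nodes.\<close>

lemma exists_vanishing_network: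
  fixes \<Omega> \<Omega>h :: "(real ^ 'n) set"
  assumes "finite \<Omega>h" and "p \<in> preactivations \<sigma> i" and "infinite (p ` \<Omega>)"
    and "(continuous_on UNIV \<sigma> \<and> \<not> polynomial_fun \<sigma>) \<or>
      (C_k (card \<Omega>h) \<sigma> \<and> (\<exists>s. \<forall>k\<le>card \<Omega>h. (deriv ^^ k) \<sigma> s \<noteq> 0))"
  shows "\<exists>v\<in>preactivations \<sigma> (Suc i). (\<forall>x\<in>\<Omega>h. v x = 0) \<and> (\<exists>z\<in>\<Omega>. v z \<noteq> 0)"
proof (rule ccontr)
  assume none: "\<not> ?thesis"
  obtain z where z: "z \<in> \<Omega>" "p z \<notin> p ` \<Omega>h"
    using assms(1,3) by (metis finite_imageI finite_subset image_subsetI)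
  then have "z \<notin> \<Omega>h" by blast
  have scale: "(\<lambda>x. t * v x) \<in> preactivations \<sigma> (Suc i)"
    if "v \<in> preactivations \<sigma> (Suc i)" for t and v :: "real ^ 'n \<Rightarrow> real"
    using preactivations_affine[OF that, of t 0] by (simp only: add_0_right)
  have "\<exists>c. \<forall>v\<in>preactivations \<sigma> (Suc i). v z = (\<Sum>x\<in>\<Omega>h. c x * v x)"
    using none z(1) scale
    by (intro dependence_on_finitely_many_values assms(1) preactivations_add) blast+
  then obtain c where c: "\<And>v. v \<in> preactivations \<sigma> (Suc i) \<Longrightarrow> v z = (\<Sum>x\<in>\<Omega>h. c x * v x)"
    by blast
  \<comment> \<open>The coefficient \<open>- 1\<close> at \<open>z\<close> brings both sides of the dependence together.\<close>
  have "(\<Sum>x\<in>insert z \<Omega>h. (c(z := - 1)) x * \<sigma> (w * p x + b)) = 0" for w b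
  proof -
    have "(\<Sum>x\<in>\<Omega>h. (c(z := - 1)) x * \<sigma> (w * p x + b)) = (\<Sum>x\<in>\<Omega>h. c x * \<sigma> (w * p x + b))"
      using \<open>z \<notin> \<Omega>h\<close> by (intro sum.cong) auto
    also have "\<dots> = \<sigma> (w * p z + b)"
      using c[OF preactivations_activated[OF preactivations_affine[OF assms(2)]]] by simp
    finally show ?thesis using \<open>z \<notin> \<Omega>h\<close> assms(1) by simp
  qed
  then show False
    using no_nontrivial_ridge_relation[of \<Omega>h z p "c(z := - 1)" \<sigma>] assms(1,4) z(2) \<open>z \<notin> \<Omega>h\<close>
    by simp
qed

lemma not_polynomial_fun_relu: "\<not> polynomial_fun relu"
proof
  assume "polynomial_fun relu"
  then obtain p where p: "poly p x = max 0 x" for x :: real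
    by (metis polynomial_fun_def relu_def)
  have "{..0::real} \<subseteq> {x. poly p x = 0}" by (auto simp: p)
  then have "infinite {x. poly p x = 0}"
    using infinite_Iic finite_subset by blast
  then have "p = 0" using poly_roots_finite by blast
  with p[of 1] show False by simp
qed

lemma J_reg_cong:
  assumes "\<And>x. x \<in> \<Omega>h \<Longrightarrow> u x = v x"
  shows "J_reg \<Omega>h m c R \<alpha> \<omega>D \<omega>R g u = J_reg \<Omega>h m c R \<alpha> \<omega>D \<omega>R g v"
proof -
  have "finite_difference \<Omega>h c \<beta> u x = finite_difference \<Omega>h c \<beta> v x" for \<beta> x
    unfolding finite_difference_def using assms by (intro sum.cong) auto
  moreover have "(\<Sum>x\<in>\<Omega>h. \<omega>D x * \<bar>u x - g x\<bar> ^ \<tau>) = (\<Sum>x\<in>\<Omega>h. \<omega>D x * \<bar>v x - g x\<bar> ^ \<tau>)" for \<tau>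
    using assms by (intro sum.cong) auto
  ultimately show ?thesis by (simp add: J_reg_def)
qed

theorem theorem4p3:
  fixes \<Omega> \<Omega>h :: "(real ^ 'n) set"
    and \<sigma> :: "real \<Rightarrow> real"
    and L m :: nat
    and c :: "('n \<Rightarrow> nat) \<Rightarrow> real ^ 'n \<Rightarrow> real ^ 'n \<Rightarrow> real"
    and R :: "(('n \<Rightarrow> nat) \<Rightarrow> real) \<Rightarrow> ennreal"
    and \<alpha> :: "nat \<Rightarrow> real"
    and \<omega>D \<omega>R g :: "real ^ 'n \<Rightarrow> real"
  defines "H \<equiv> neural_networks_on \<Omega> \<sigma> L"
    and "J \<equiv> J_reg \<Omega>h m c R \<alpha> \<omega>D \<omega>R g"
  assumes "bounded_lipschitz_domain \<Omega>"
    and "finite \<Omega>h" and "\<Omega>h \<noteq> {}" and "\<Omega>h \<subseteq> \<Omega>"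
    and "m \<ge> 1"
    and "R \<in> borel_measurable (jet_space m)"
    and "R (\<lambda>\<beta>\<in>multi_indices m. 0) = 0"
    and "\<alpha> 1 \<ge> 0" and "\<alpha> 2 \<ge> 0"
    and "\<And>x. x \<in> \<Omega>h \<Longrightarrow> \<omega>D x \<ge> 0"
    and "\<And>x. x \<in> \<Omega>h \<Longrightarrow> \<omega>R x \<ge> 0"
    and "L \<ge> 2"
    and "\<sigma> = relu
      \<or> (\<not> polynomial_fun \<sigma> \<and> continuous_on UNIV \<sigma> \<and> (L > 2 \<longrightarrow> strictly_monotone \<sigma>))
      \<or> (C_k (card \<Omega>h) \<sigma> \<and> (\<exists>s. \<forall>k\<le>card \<Omega>h. (deriv ^^ k) \<sigma> s \<noteq> 0) \<and>
         (L > 2 \<longrightarrow> strictly_monotone \<sigma>))"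
    and "\<exists>u. is_arg_min J (\<lambda>u. u \<in> H) u"
  shows "infinite {u. is_arg_min J (\<lambda>u. u \<in> H) u}"
proof -
  note activation = \<open>\<sigma> = relu \<or> _\<close>
  define i where "i = L - 2"
  have L: "L = Suc (Suc i)" using \<open>L \<ge> 2\<close> by (simp add: i_def)
  have \<Omega>: "open \<Omega>" "bounded \<Omega>" "\<Omega> \<noteq> {}"
    using \<open>bounded_lipschitz_domain \<Omega>\<close> \<open>\<Omega>h \<noteq> {}\<close> \<open>\<Omega>h \<subseteq> \<Omega>\<close>
    by (auto simp: bounded_lipschitz_domain_def)
  have "\<sigma> = relu \<or> (i > 0 \<longrightarrow> strictly_monotone \<sigma>)"
    using activation L by auto
  then obtain p :: "real ^ 'n \<Rightarrow> real" where p: "p \<in> preactivations \<sigma> i" "infinite (p ` \<Omega>)"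
    using exists_preactivation_with_infinite_image[OF \<Omega>] by blast
  have "continuous_on UNIV relu"
    unfolding relu_def by (intro continuous_intros)
  then have "(continuous_on UNIV \<sigma> \<and> \<not> polynomial_fun \<sigma>) \<or>
      (C_k (card \<Omega>h) \<sigma> \<and> (\<exists>s. \<forall>k\<le>card \<Omega>h. (deriv ^^ k) \<sigma> s \<noteq> 0))"
    using activation not_polynomial_fun_relu by blast
  then obtain v z where v: "v \<in> preactivations \<sigma> (Suc i)" "\<And>x. x \<in> \<Omega>h \<Longrightarrow> v x = 0"
    and z: "z \<in> \<Omega>" "v z \<noteq> 0"
    using exists_vanishing_network[OF \<open>finite \<Omega>h\<close> p] by blast
  obtain u where u: "is_arg_min J (\<lambda>u. u \<in> H) u"
    using \<open>\<exists>u. is_arg_min J (\<lambda>u. u \<in> H) u\<close> by blast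
  have H: "H = (\<lambda>f. restrict f \<Omega>) ` preactivations \<sigma> (Suc i)"
    by (simp add: H_def neural_networks_on_def L neural_networks_eq_preactivations)
  have "u \<in> H" using u by (simp add: is_arg_min_def)
  then obtain f where f: "f \<in> preactivations \<sigma> (Suc i)" "u = restrict f \<Omega>"
    unfolding H by blast
  \<comment> \<open>Moving \<open>u\<close> along the line spanned by \<open>v\<close> changes no value on \<open>\<Omega>h\<close>.\<close>
  define U where "U t = restrict (\<lambda>x. f x + (t * v x + 0)) \<Omega>" for t
  have "U t \<in> H" for t
    unfolding H U_def by (intro imageI preactivations_add f(1) preactivations_affine v(1))
  moreover have "J (U t) = J u" for t
    unfolding J_def using v(2) \<open>\<Omega>h \<subseteq> \<Omega>\<close>
    by (intro J_reg_cong) (auto simp: U_def f(2))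
  ultimately have "range U \<subseteq> {u. is_arg_min J (\<lambda>u. u \<in> H) u}"
    using u by (auto simp: is_arg_min_def)
  moreover have "inj U"
  proof (rule injI)
    fix s t assume "U s = U t"
    from fun_cong[OF this, of z] z show "s = t" by (simp add: U_def)
  qed
  then have "infinite (range U)"
    using finite_imageD infinite_UNIV_char_0 by blast
  ultimately show ?thesis
    using finite_subset by blast
qed

end
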